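(* Let $\alpha>0$ and $\beta>0$, and set $\tilde E_{\alpha,\beta}(x)=\Gamma(\beta)E_{\alpha,\beta}(x)$. Then the following three conditions are equivalent: (i) $E_{\alpha,\beta}$ is log-convex on $\mathbb{R}^+$; (ii) $\tilde E_{\alpha,\beta}$ is super-additive on $\mathbb{R}^+$, i.e. $\tilde E_{\alpha,\beta}(z+s)\ge\tilde E_{\alpha,\beta}(z)\tilde E_{\alpha,\beta}(s)$ for all $z,s\in\mathbb{R}^+$; (iii) $\alpha\le 1$ and $\beta\ge h(\alpha)$. Similarly, the following three conditions are equivalent: (i') $E_{\alpha,\beta}$ is log-concave on $\mathbb{R}^+$; (ii') $\tilde E_{\alpha,\beta}$ is sub-additive on $\mathbb{R}^+$, i.e. $\tilde E_{\alpha,\beta}(z+s)\le\tilde E_{\alpha,\beta}(z)\tilde E_{\alpha,\beta}(s)$ for all $z,s\in\mathbb{R}^+$; (iii') $\alpha\ge 1$ and $\beta\le h(\alpha)$.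
   Context: For $\alpha>0$ and $\beta\in\mathbb{R}$, the two-parameter Mittag-Leffler function is the entire function $E_{\alpha,\beta}(z)=\sum_{k=0}^{\infty}\frac{z^k}{\Gamma(\alpha k+\beta)}$, $z\in\mathbb{C}$. For each $x>0$, $h(x)$ denotes the unique solution $y=h(x)>0$ of the equation $2\,\Gamma(x+y)^2=\Gamma(y)\,\Gamma(2x+y)$ (existence and uniqueness hold for every $x>0$). $\mathbb{R}^+$ is the positive half-line; log-convex (resp. log-concave) means that $\log E_{\alpha,\beta}$ is convex (resp. concave) there. The terms super-additive and sub-additive are used here in the multiplicative sense written out in the claim. *)

theory Defs
  imports "HOL-Analysis.Analysis"
begin

text \<open>
  The definition is generic in the type of the argument: at type \<^typ>\<open>complex\<close> it is the entire
  function, at type \<^typ>\<open>real\<close> its restriction to the real axis. At a pole \<^const>\<open>Gamma\<close> is 0 in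
  HOL-Analysis, so division by it gives the usual convention that the reciprocal Gamma function
  vanishes there.
\<close>

definition mittag_leffler :: "real \<Rightarrow> real \<Rightarrow> 'a :: {real_normed_field, banach} \<Rightarrow> 'a" where
  "mittag_leffler \<alpha> \<beta> z = (\<Sum>k. z ^ k / of_real (Gamma (\<alpha> * real k + \<beta>)))"

definition mittag_leffler_normalized :: "real \<Rightarrow> real \<Rightarrow> real \<Rightarrow> real" where
  "mittag_leffler_normalized \<alpha> \<beta> x = Gamma \<beta> * mittag_leffler \<alpha> \<beta> x"

text \<open>Meaningful for positive \<open>x\<close> only, where the solution exists and is unique.\<close>

definition h :: "real \<Rightarrow> real" where
  "h x = (THE y. y > 0 \<and> 2 * (Gamma (x + y))\<^sup>2 = Gamma y * Gamma (2 * x + y))"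

text \<open>
  Intended for functions that are positive on the set, as \<^term>\<open>mittag_leffler \<alpha> \<beta>\<close> is on the
  positive half-line for positive parameters.
\<close>

definition log_convex_on :: "real set \<Rightarrow> (real \<Rightarrow> real) \<Rightarrow> bool" where
  "log_convex_on S f \<longleftrightarrow> convex_on S (\<lambda>x. ln (f x))"

definition log_concave_on :: "real set \<Rightarrow> (real \<Rightarrow> real) \<Rightarrow> bool" where
  "log_concave_on S f \<longleftrightarrow> concave_on S (\<lambda>x. ln (f x))"

definition mult_super_additive_on :: "real set \<Rightarrow> (real \<Rightarrow> real) \<Rightarrow> bool" where
  "mult_super_additive_on S f \<longleftrightarrow> (\<forall>z\<in>S. \<forall>s\<in>S. f (z + s) \<ge> f z * f s)"

definition mult_sub_additive_on :: "real set \<Rightarrow> (real \<Rightarrow> real) \<Rightarrow> bool" where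
  "mult_sub_additive_on S f \<longleftrightarrow> (\<forall>z\<in>S. \<forall>s\<in>S. f (z + s) \<le> f z * f s)"

end

(*
  Write P(y) = Gamma(y + a) / Gamma(y). Its logarithmic derivative is D(y) = psi(y + a) - psi(y) and
  P''/P = u with u = D^2 + D'. The recurrence of psi gives
  u(y) - u(y + 1) = 2a / (y (y + a)) * (psi(y + a) - psi(y + 1)), and u(y + n) tends to 0, so
  u <= 0 for a <= 1 and u >= 0 for a >= 1: P is concave resp. convex.

  The ratio of the k-th coefficients of E' and E is (k + 1) / P(a k + b). It is monotone in k once
  the concave (convex) sequence P(a k + b), extended by 0 at k = -1, is still concave (convex), that
  is, once P(b + a) <= 2 P(b) (resp. >=), which is the condition b >= h(a) (resp. b <= h(a)).
  Monotone coefficient ratios make E'/E monotone. Conversely, super-additivity near 0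
  compares the x^2-coefficients of E(2x) and E(x)^2, while for large x it forces at least exponential
  growth, which fails for a > 1; dually for sub-additivity.
*)

theory Submission
  imports Defs "HOL-Real_Asymp.Real_Asymp"
begin

subsection \<open>Concavity and convexity of quotients of Gamma values\<close>

definition gamma_ratio :: "real \<Rightarrow> real \<Rightarrow> real" where
  "gamma_ratio a y = Gamma (y + a) / Gamma y"

definition digamma_diff :: "real \<Rightarrow> real \<Rightarrow> real" where
  "digamma_diff a y = Digamma (y + a) - Digamma y"

text \<open>For \<open>P = gamma_ratio a\<close> this is P''/P, so its sign decides between
  concavity and convexity of P.\<close>

definition gamma_ratio_curvature :: "real \<Rightarrow> real \<Rightarrow> real" where
  "gamma_ratio_curvature a y = (digamma_diff a y)\<^sup>2 + (Polygamma 1 (y + a) - Polygamma 1 y)"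

lemma pos_notin_nonpos_Ints: "(y::real) > 0 \<Longrightarrow> y \<notin> \<int>\<^sub>\<le>\<^sub>0"
  by (auto elim!: nonpos_Ints_cases)

lemma gamma_ratio_pos: "a > 0 \<Longrightarrow> y > 0 \<Longrightarrow> gamma_ratio a y > 0"
  by (simp add: gamma_ratio_def)

lemma Polygamma_1_plus1:
  "(y::real) > 0 \<Longrightarrow> Polygamma 1 (y + 1) = Polygamma 1 y - 1 / y\<^sup>2"
  using Polygamma_plus1[of y 1] by (simp add: power2_eq_square)

text \<open>Each of the \<open>N\<close> recurrence steps adds at most 1/y. This crude bound
  suffices, since it serves only to make the difference vanish at infinity.\<close>

lemma Digamma_diff_le:
  assumes "(y::real) > 0"
  shows "Digamma (y + real N) - Digamma y \<le> real N / y"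
proof (induction N)
  case (Suc N)
  have "Digamma (y + real (Suc N)) = Digamma (y + real N) + 1 / (y + real N)"
    using Digamma_plus1[of "y + real N"] assms by (simp add: add_ac)
  also have "1 / (y + real N) \<le> 1 / y"
    using assms by (intro divide_left_mono) auto
  finally show ?case
    using Suc by (simp add: add_divide_distrib)
qed simp

lemma Polygamma_1_diff_ge:
  assumes "(y::real) > 0"
  shows "Polygamma 1 (y + real N) - Polygamma 1 y \<ge> - real N / y\<^sup>2"
proof (induction N)
  case (Suc N)
  have "Polygamma 1 (y + real (Suc N)) = Polygamma 1 (y + real N) - 1 / (y + real N)\<^sup>2"
    using Polygamma_1_plus1[of "y + real N"] assms by (simp add: add_ac)
  moreover have "1 / (y + real N)\<^sup>2 \<le> 1 / y\<^sup>2"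
    using assms by (intro divide_left_mono power_mono) auto
  ultimately show ?case
    using Suc by (simp add: add_divide_distrib diff_divide_distrib)
qed simp

text \<open>Monotonicity of \<open>Digamma\<close> replaces the real shift \<open>a\<close> by its
  ceiling, where the recurrence bound applies.\<close>

lemma digamma_diff_bounds:
  assumes "a > 0" "y > 0"
  shows "0 < digamma_diff a y" "digamma_diff a y \<le> real (nat \<lceil>a\<rceil>) / y"
proof -
  show "0 < digamma_diff a y"
    using Digamma_real_strict_mono[of y "y + a"] assms by (simp add: digamma_diff_def)
  have "y + a \<le> y + real (nat \<lceil>a\<rceil>)"
    by (simp add: real_nat_ceiling_ge)
  then show "digamma_diff a y \<le> real (nat \<lceil>a\<rceil>) / y"
    using Digamma_real_mono[of "y + a" "y + real (nat \<lceil>a\<rceil>)"] Digamma_diff_le[of y "nat \<lceil>a\<rceil>"] assms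
    by (simp add: digamma_diff_def)
qed

lemma Polygamma_1_diff_bounds:
  assumes "a > 0" "(y::real) > 0"
  shows "Polygamma 1 (y + a) - Polygamma 1 y < 0"
    and "Polygamma 1 (y + a) - Polygamma 1 y \<ge> - real (nat \<lceil>a\<rceil>) / y\<^sup>2"
proof -
  show "Polygamma 1 (y + a) - Polygamma 1 y < 0"
    using Polygamma_real_strict_antimono[of y "y + a" 1] assms by simp
  have "y + a \<le> y + real (nat \<lceil>a\<rceil>)"
    by (simp add: real_nat_ceiling_ge)
  \<comment> \<open>Strict antitonicity requires distinct arguments; if \<open>a\<close> is an
    integer, both sides coincide.\<close>
  then have "Polygamma 1 (y + real (nat \<lceil>a\<rceil>)) \<le> Polygamma 1 (y + a)"
    using Polygamma_real_strict_antimono[of "y + a" "y + real (nat \<lceil>a\<rceil>)" 1] assms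
    by (cases "a = real (nat \<lceil>a\<rceil>)") (auto simp: less_le)
  then show "Polygamma 1 (y + a) - Polygamma 1 y \<ge> - real (nat \<lceil>a\<rceil>) / y\<^sup>2"
    using Polygamma_1_diff_ge[of y "nat \<lceil>a\<rceil>"] assms by simp
qed

lemma gamma_ratio_curvature_step:
  assumes "a > 0" "y > 0"
  shows "gamma_ratio_curvature a y - gamma_ratio_curvature a (y + 1) =
    2 * a / (y * (y + a)) * (Digamma (y + a) - Digamma (y + 1))"
proof -
  define d where "d = digamma_diff a y"
  have D: "digamma_diff a (y + 1) = d + (1 / (y + a) - 1 / y)"
    using Digamma_plus1[of "y + a"] Digamma_plus1[of y] assms
    by (simp add: d_def digamma_diff_def add_ac)
  have P: "Polygamma 1 (y + 1 + a) - Polygamma 1 (y + 1) =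
      Polygamma 1 (y + a) - Polygamma 1 y - 1 / (y + a)\<^sup>2 + 1 / y\<^sup>2"
    using Polygamma_1_plus1[of "y + a"] Polygamma_1_plus1[of y] assms by (simp add: add_ac)
  have R: "Digamma (y + a) - Digamma (y + 1) = d - 1 / y"
    using Digamma_plus1[of y] assms by (simp add: d_def digamma_diff_def)
  \<comment> \<open>With u = 1/y and v = 1/(y + a), the shift by 1 changes \<open>d\<close> by v - u
    and the trigamma difference by u^2 - v^2. The quadratic terms factor, and d - u is the
    \<open>Digamma\<close> difference in the claim.\<close>
  have "d\<^sup>2 - (d + (v - u))\<^sup>2 + v\<^sup>2 - u\<^sup>2 = 2 * (u - v) * (d - u)" for u v
    by (simp add: power2_eq_square algebra_simps)
  from this[of "1 / (y + a)" "1 / y"]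
  have "d\<^sup>2 - (d + (1 / (y + a) - 1 / y))\<^sup>2 + 1 / (y + a)\<^sup>2 - 1 / y\<^sup>2 =
      2 * (1 / y - 1 / (y + a)) * (d - 1 / y)"
    by (simp add: power_one_over)
  also have "1 / y - 1 / (y + a) = a / (y * (y + a))"
    using assms by (simp add: field_simps)
  finally show ?thesis
    unfolding R gamma_ratio_curvature_def D P d_def[symmetric] by simp
qed

text \<open>Both differences are squeezed to 0, by bounds of order 1/y and 1/y^2.\<close>

lemma gamma_ratio_curvature_tendsto_0:
  assumes "a > 0" "y > 0"
  shows "(\<lambda>n. gamma_ratio_curvature a (y + real n)) \<longlonglongrightarrow> 0"
proof -
  define N where "N = real (nat \<lceil>a\<rceil>)"
  have lim: "(\<lambda>n. N / (y + real n)) \<longlonglongrightarrow> 0" "(\<lambda>n. - N / (y + real n)\<^sup>2) \<longlonglongrightarrow> 0"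
    by real_asymp+
  have "(\<lambda>n. digamma_diff a (y + real n)) \<longlonglongrightarrow> 0"
    by (rule tendsto_sandwich[OF _ _ tendsto_const lim(1)])
       (use digamma_diff_bounds[of a] assms in \<open>auto simp: N_def intro!: always_eventually less_imp_le\<close>)
  moreover have "(\<lambda>n. Polygamma 1 (y + real n + a) - Polygamma 1 (y + real n)) \<longlonglongrightarrow> 0"
  proof (rule tendsto_sandwich[OF _ _ lim(2) tendsto_const])
    show "\<forall>\<^sub>F n in sequentially. - N / (y + real n)\<^sup>2 \<le> Polygamma 1 (y + real n + a) - Polygamma 1 (y + real n)"
      unfolding N_def
      by (intro always_eventually allI Polygamma_1_diff_bounds) (use assms in auto)
    show "\<forall>\<^sub>F n in sequentially. Polygamma 1 (y + real n + a) - Polygamma 1 (y + real n) \<le> 0"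
      by (intro always_eventually allI less_imp_le Polygamma_1_diff_bounds) (use assms in auto)
  qed
  ultimately have "(\<lambda>n. (digamma_diff a (y + real n))\<^sup>2 +
      (Polygamma 1 (y + real n + a) - Polygamma 1 (y + real n))) \<longlonglongrightarrow> 0\<^sup>2 + 0"
    by (intro tendsto_intros)
  then show ?thesis
    by (simp add: gamma_ratio_curvature_def)
qed

text \<open>For a \<le> 1 the step formula makes the values at y, y + 1, y + 2, ... increase to
  their limit 0, so the first of them is at most 0.\<close>

lemma gamma_ratio_curvature_nonpos:
  assumes "0 < a" "a \<le> 1" "y > 0"
  shows "gamma_ratio_curvature a y \<le> 0"
proof -
  have "incseq (\<lambda>n. gamma_ratio_curvature a (y + real n))"
  proof (rule incseq_SucI)
    fix n
    have "Digamma (y + real n + a) \<le> Digamma (y + real n + 1)"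
      using assms by (intro Digamma_real_mono) auto
    then have "2 * a / ((y + real n) * (y + real n + a)) *
        (Digamma (y + real n + a) - Digamma (y + real n + 1)) \<le> 0"
      using assms by (intro mult_nonneg_nonpos) auto
    then show "gamma_ratio_curvature a (y + real n) \<le> gamma_ratio_curvature a (y + real (Suc n))"
      using gamma_ratio_curvature_step[of a "y + real n"] assms by (simp add: add_ac)
  qed
  from incseq_le[OF this gamma_ratio_curvature_tendsto_0, of 0] assms show ?thesis
    by simp
qed

lemma gamma_ratio_curvature_nonneg:
  assumes "a \<ge> 1" "y > 0"
  shows "gamma_ratio_curvature a y \<ge> 0"
proof -
  have "decseq (\<lambda>n. gamma_ratio_curvature a (y + real n))"
  proof (rule decseq_SucI)
    fix n
    have "Digamma (y + real n + a) \<ge> Digamma (y + real n + 1)"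
      using assms by (intro Digamma_real_mono) auto
    then have "2 * a / ((y + real n) * (y + real n + a)) *
        (Digamma (y + real n + a) - Digamma (y + real n + 1)) \<ge> 0"
      using assms by (intro mult_nonneg_nonneg) auto
    then show "gamma_ratio_curvature a (y + real n) \<ge> gamma_ratio_curvature a (y + real (Suc n))"
      using gamma_ratio_curvature_step[of a "y + real n"] assms by (simp add: add_ac)
  qed
  from decseq_ge[OF this gamma_ratio_curvature_tendsto_0, of 0] assms show ?thesis
    by simp
qed

lemma DERIV_gamma_ratio:
  assumes "a > 0" "y > 0"
  shows "(gamma_ratio a has_real_derivative gamma_ratio a y * digamma_diff a y) (at y)"
proof -
  have "Gamma y \<noteq> 0"
    using Gamma_real_pos[of y] assms by linarith
  then show ?thesis
    unfolding gamma_ratio_def[abs_def] digamma_diff_def using assms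
    by (auto intro!: derivative_eq_intros pos_notin_nonpos_Ints simp: field_simps)
qed

lemma DERIV_gamma_ratio2:
  assumes "a > 0" "y > 0"
  shows "((\<lambda>y. gamma_ratio a y * digamma_diff a y) has_real_derivative
    gamma_ratio a y * gamma_ratio_curvature a y) (at y)"
proof -
  have "(digamma_diff a has_real_derivative (Polygamma 1 (y + a) - Polygamma 1 y)) (at y)"
    unfolding digamma_diff_def[abs_def] using assms
    by (auto intro!: derivative_eq_intros pos_notin_nonpos_Ints)
  from DERIV_mult[OF DERIV_gamma_ratio[OF assms] this] show ?thesis
    by (simp add: gamma_ratio_curvature_def power2_eq_square algebra_simps)
qed

lemma concave_on_gamma_ratio:
  assumes "0 < a" "a \<le> 1"
  shows "concave_on {0<..} (gamma_ratio a)"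
  by (rule f''_le0_imp_concave[OF _ DERIV_gamma_ratio DERIV_gamma_ratio2])
     (use assms gamma_ratio_pos[of a] gamma_ratio_curvature_nonpos[of a] in
       \<open>auto simp: mult_le_0_iff less_imp_le\<close>)

lemma convex_on_gamma_ratio:
  assumes "a \<ge> 1"
  shows "convex_on {0<..} (gamma_ratio a)"
  by (rule f''_ge0_imp_convex[OF _ DERIV_gamma_ratio DERIV_gamma_ratio2])
     (use assms gamma_ratio_pos[of a] gamma_ratio_curvature_nonneg[of a] in
       \<open>auto simp: zero_le_mult_iff less_imp_le\<close>)

subsection \<open>Power series and super-additivity\<close>

text \<open>A concave sequence that vanishes at index -1 has a decreasing quotient p k / (k + 1);
  \<open>start\<close> is concavity at index 0 with that extension. Clearing denominators leaves the
  sign of \<open>p\<close> free, so that the convex case can be treated by passing to the negated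
  sequence.\<close>

lemma concave_seq_ratio_antimono:
  fixes p :: "nat \<Rightarrow> real"
  assumes concave: "\<And>k. p k + p (k + 2) \<le> 2 * p (k + 1)" and start: "p 1 \<le> 2 * p 0"
  shows "real (k + 1) * p (k + 1) \<le> real (k + 2) * p k"
proof (induction k)
  case 0
  then show ?case using start by simp
next
  case (Suc k)
  have "real (k + 2) * p (k + 2) \<le> real (k + 2) * (2 * p (k + 1) - p k)"
    using concave[of k] by (intro mult_left_mono) auto
  also have "\<dots> \<le> real (k + 2) * (2 * p (k + 1)) - real (k + 1) * p (k + 1)"
    using Suc.IH by (simp add: algebra_simps)
  also have "\<dots> = real (k + 3) * p (k + 1)"
    by (simp add: algebra_simps)
  finally show ?case by (simp add: add_ac)
qed

lemma power_mult_power_le: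
  fixes x y :: real
  assumes "0 \<le> x" "x \<le> y" "j \<le> k"
  shows "x ^ k * y ^ j \<le> x ^ j * y ^ k"
proof -
  obtain d where k: "k = j + d" using assms le_Suc_ex by blast
  have "x ^ d * (x ^ j * y ^ j) \<le> y ^ d * (x ^ j * y ^ j)"
    using assms by (intro mult_right_mono power_mono) auto
  then show ?thesis by (simp add: k power_add mult_ac)
qed

text \<open>
  Symmetrizing the double sum over \<open>(j, k)\<close> turns the difference of the two sides into a sum of
  products of two factors of equal sign.
\<close>

lemma finite_power_series_ratio_mono:
  fixes p q :: "nat \<Rightarrow> real"
  assumes pq: "\<And>j k. j \<le> k \<Longrightarrow> p j * q k \<le> p k * q j" and xy: "0 \<le> x" "x \<le> y"
  shows "(\<Sum>j<n. p j * x ^ j) * (\<Sum>k<n. q k * y ^ k) \<le> (\<Sum>j<n. p j * y ^ j) * (\<Sum>k<n. q k * x ^ k)"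
proof -
  define c where "c j k = p j * q k * (x ^ j * y ^ k - y ^ j * x ^ k)" for j k
  have "c j k + c k j \<le> 0" for j k
  proof -
    have eq: "c j k + c k j = (p j * q k - p k * q j) * (x ^ j * y ^ k - y ^ j * x ^ k)"
      by (simp add: c_def algebra_simps)
    show ?thesis
    proof (cases "j \<le> k")
      case True
      then show ?thesis
        unfolding eq using pq[of j k] power_mult_power_le[OF xy True]
        by (intro mult_nonpos_nonneg) (auto simp: mult_ac)
    next
      case False
      then have "k \<le> j" by simp
      then show ?thesis
        unfolding eq using pq[of k j] power_mult_power_le[OF xy \<open>k \<le> j\<close>]
        by (intro mult_nonneg_nonpos) (auto simp: mult_ac)
    qed
  qed
  then have "(\<Sum>j<n. \<Sum>k<n. c j k + c k j) \<le> 0"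
    by (intro sum_nonpos) auto
  also have "(\<Sum>j<n. \<Sum>k<n. c j k + c k j) = 2 * (\<Sum>j<n. \<Sum>k<n. c j k)"
    using sum.swap[of "\<lambda>j k. c k j" "{..<n}" "{..<n}"] by (simp add: sum.distrib)
  also have "(\<Sum>j<n. \<Sum>k<n. c j k) =
      (\<Sum>j<n. p j * x ^ j) * (\<Sum>k<n. q k * y ^ k) - (\<Sum>j<n. p j * y ^ j) * (\<Sum>k<n. q k * x ^ k)"
    by (simp add: c_def sum_product sum_subtractf algebra_simps)
  finally show ?thesis by simp
qed

text \<open>The inequality for partial sums passes to the limit. In product form, \<open>p\<close>
  and \<open>q\<close> can be swapped, which turns an increasing quotient of series into a
  decreasing one.\<close>

lemma power_series_ratio_mono:
  fixes p q :: "nat \<Rightarrow> real"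
  assumes pq: "\<And>j k. j \<le> k \<Longrightarrow> p j * q k \<le> p k * q j" and xy: "0 \<le> x" "x \<le> y"
    and p: "\<And>x. summable (\<lambda>n. p n * x ^ n)" and q: "\<And>x. summable (\<lambda>n. q n * x ^ n)"
  shows "(\<Sum>j. p j * x ^ j) * (\<Sum>k. q k * y ^ k) \<le> (\<Sum>j. p j * y ^ j) * (\<Sum>k. q k * x ^ k)"
  by (rule LIMSEQ_le[OF tendsto_mult[OF summable_LIMSEQ[OF p] summable_LIMSEQ[OF q]]
        tendsto_mult[OF summable_LIMSEQ[OF p] summable_LIMSEQ[OF q]]])
     (auto intro!: exI[of _ 0] finite_power_series_ratio_mono pq xy)

section \<open>Comparison of power series with exponentials\<close>

lemma eventually_decreasing_imp_bounded:
  fixes w :: "nat \<Rightarrow> real"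
  assumes "\<And>k. 0 \<le> w k" "\<forall>\<^sub>F k in sequentially. w (Suc k) \<le> w k"
  obtains K where "K > 0" "\<And>k. w k \<le> K"
proof -
  obtain N where N: "w (Suc k) \<le> w k" if "k \<ge> N" for k
    using assms(2) by (auto simp: eventually_at_top_linorder)
  \<comment> \<open>The sum dominates each of its nonnegative terms; adding 1 keeps \<open>K\<close>
    positive.\<close>
  define K where "K = (\<Sum>k\<le>N. w k) + 1"
  have init: "w k \<le> K" if "k \<le> N" for k
    using member_le_sum[of k "{..N}" w] that assms(1) by (auto simp: K_def)
  have "w k \<le> K" for k
  proof (cases "k \<le> N")
    case False
    then have "N \<le> k" by simp
    then show ?thesis
      by (induction rule: dec_induct) (use init N order_trans in blast)+
  qed (rule init)
  moreover have "K > 0"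
    using assms(1) by (auto simp: K_def intro!: add_nonneg_pos sum_nonneg)
  ultimately show ?thesis using that by blast
qed

text \<open>The ratio hypothesis makes a k * k! / M^k eventually decreasing, hence bounded by some
  K; the series is then dominated term by term by that of K * exp (M * x).\<close>

lemma power_series_le_exp:
  fixes a :: "nat \<Rightarrow> real"
  assumes a: "\<And>k. a k > 0" and M: "M > 0" and summ: "\<And>x. summable (\<lambda>n. a n * x ^ n)"
    and ratio: "\<forall>\<^sub>F k in sequentially. real (Suc k) * a (Suc k) \<le> M * a k"
  obtains K where "K > 0" "\<And>x. x \<ge> 0 \<Longrightarrow> (\<Sum>k. a k * x ^ k) \<le> K * exp (M * x)"
proof -
  have ev: "\<forall>\<^sub>F k in sequentially. a (Suc k) * fact (Suc k) / M ^ Suc k \<le> a k * fact k / M ^ k"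
    using ratio
  proof eventually_elim
    case (elim k)
    have "a (Suc k) * fact (Suc k) / M ^ Suc k = (real (Suc k) * a (Suc k)) * (fact k / M ^ Suc k)"
      by simp
    also have "\<dots> \<le> (M * a k) * (fact k / M ^ Suc k)"
      using elim M by (intro mult_right_mono) auto
    also have "\<dots> = a k * fact k / M ^ k"
      using M by simp
    finally show ?case .
  qed
  obtain K where K: "K > 0" "\<And>k. a k * fact k / M ^ k \<le> K"
    by (rule eventually_decreasing_imp_bounded[OF _ ev]) (use a M in \<open>auto simp: less_imp_le\<close>)
  have "(\<Sum>k. a k * x ^ k) \<le> K * exp (M * x)" if "x \<ge> 0" for x
  proof -
    have "(\<lambda>k. K * ((M * x) ^ k /\<^sub>R fact k)) sums (K * exp (M * x))"
      by (intro sums_mult exp_converges)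
    moreover have "a k * x ^ k \<le> K * ((M * x) ^ k /\<^sub>R fact k)" for k
    proof -
      have "a k * x ^ k = (a k * fact k / M ^ k) * ((M * x) ^ k / fact k)"
        using M by (simp add: power_mult_distrib)
      also have "\<dots> \<le> K * ((M * x) ^ k / fact k)"
        using K M that by (intro mult_right_mono) auto
      finally show ?thesis by (simp add: field_simps)
    qed
    ultimately show ?thesis
      using suminf_le[OF _ summ, of x "\<lambda>k. K * ((M * x) ^ k /\<^sub>R fact k)"]
      by (auto simp: sums_iff)
  qed
  with K show ?thesis using that by blast
qed

text \<open>Here the reciprocals M^k / (a k * k!) are eventually decreasing, and a bound K for them
  yields the constant 1 / K.\<close>

lemma power_series_ge_exp:
  fixes a :: "nat \<Rightarrow> real"
  assumes a: "\<And>k. a k > 0" and M: "M > 0" and summ: "\<And>x. summable (\<lambda>n. a n * x ^ n)"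
    and ratio: "\<forall>\<^sub>F k in sequentially. real (Suc k) * a (Suc k) \<ge> M * a k"
  obtains K where "K > 0" "\<And>x. x \<ge> 0 \<Longrightarrow> (\<Sum>k. a k * x ^ k) \<ge> K * exp (M * x)"
proof -
  have ev: "\<forall>\<^sub>F k in sequentially. M ^ Suc k / (a (Suc k) * fact (Suc k)) \<le> M ^ k / (a k * fact k)"
    using ratio
  proof eventually_elim
    case (elim k)
    have "M ^ Suc k / (a (Suc k) * fact (Suc k)) = M ^ Suc k / fact k / (real (Suc k) * a (Suc k))"
      by simp
    also have "\<dots> \<le> M ^ Suc k / fact k / (M * a k)"
      using elim M a[of k] a[of "Suc k"] by (intro divide_left_mono) auto
    also have "\<dots> = M ^ k / (a k * fact k)"
      using M by simp
    finally show ?case .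
  qed
  obtain K where K: "K > 0" "\<And>k. M ^ k / (a k * fact k) \<le> K"
    by (rule eventually_decreasing_imp_bounded[OF _ ev]) (use a M in \<open>auto simp: less_imp_le\<close>)
  have "(\<Sum>k. a k * x ^ k) \<ge> 1 / K * exp (M * x)" if "x \<ge> 0" for x
  proof -
    have "(\<lambda>k. 1 / K * ((M * x) ^ k /\<^sub>R fact k)) sums (1 / K * exp (M * x))"
      by (intro sums_mult exp_converges)
    moreover have "1 / K * ((M * x) ^ k /\<^sub>R fact k) \<le> a k * x ^ k" for k
    proof -
      have "M ^ k / fact k / K \<le> a k"
        using K(1) K(2)[of k] a[of k] by (simp add: field_simps)
      then have "M ^ k / fact k / K * x ^ k \<le> a k * x ^ k"
        using that by (intro mult_right_mono) auto
      then show ?thesis by (simp add: power_mult_distrib field_simps)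
    qed
    ultimately show ?thesis
      using suminf_le[OF _ _ summ, of "\<lambda>k. 1 / K * ((M * x) ^ k /\<^sub>R fact k)" x]
      by (auto simp: sums_iff)
  qed
  moreover have "1 / K > 0" using K by simp
  ultimately show ?thesis using that by blast
qed

lemma convex_on_imp_super_additive:
  fixes g :: "real \<Rightarrow> real"
  assumes convex: "convex_on {0<..} g" and cont: "\<And>x. x \<ge> 0 \<Longrightarrow> isCont g x"
    and z: "z > 0" and s: "s > 0"
  shows "g z + g s \<le> g (z + s) + g 0"
proof -
  \<comment> \<open>The chord inequality with left endpoint 0. Convexity is available only for
    positive endpoints e, so e tends to 0 from the right.\<close>
  have main: "g (l * t) \<le> l * g t + (1 - l) * g 0" if l: "0 < l" "l < 1" and t: "t > 0" for l t
  proof (rule tendsto_le[OF _ _ _])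
    have "((\<lambda>e. (1 - l) * e + l * t) \<longlongrightarrow> (1 - l) * 0 + l * t) (at_right 0)"
      by (intro tendsto_intros)
    from isCont_tendsto_compose[OF cont this] l t
    show "((\<lambda>e. g ((1 - l) * e + l * t)) \<longlongrightarrow> g (l * t)) (at_right 0)"
      by simp
    have "(g \<longlongrightarrow> g 0) (at_right 0)"
      using cont[of 0] by (simp add: isCont_def filterlim_at_split)
    then show "((\<lambda>e. l * g t + (1 - l) * g e) \<longlongrightarrow> l * g t + (1 - l) * g 0) (at_right 0)"
      by (intro tendsto_intros)
    show "\<forall>\<^sub>F e in at_right 0. g ((1 - l) * e + l * t) \<le> l * g t + (1 - l) * g e"
      using eventually_at_right_less[of 0]
    proof eventually_elim
      case (elim e)
      then show ?case
        using convex_onD[OF convex, of l e t] l t by simp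
    qed
  qed simp
  \<comment> \<open>The points z and s divide the interval from 0 to z + s in complementary
    proportions, so the weights add up to 1 when the two chord inequalities are summed.\<close>
  define l where "l = z / (z + s)"
  have "l * (z + s) = z" "(1 - l) * (z + s) = s"
    using z s by (simp_all add: l_def field_simps)
  moreover have "0 < l" "l < 1"
    using z s by (simp_all add: l_def)
  ultimately have "g z \<le> l * g (z + s) + (1 - l) * g 0" "g s \<le> (1 - l) * g (z + s) + l * g 0"
    using main[of l "z + s"] main[of "1 - l" "z + s"] z s by simp_all
  then show ?thesis by (simp add: algebra_simps)
qed

text \<open>Compares the coefficients of \<open>x\<^sup>2\<close>.\<close>

lemma power_series_square_defect_tendsto:
  fixes a :: "nat \<Rightarrow> real"
  defines "f \<equiv> \<lambda>x. \<Sum>k. a k * x ^ k"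
  assumes summ: "\<And>x. summable (\<lambda>n. a n * x ^ n)" and a0: "a 0 = 1"
  shows "((\<lambda>x. (f (2 * x) - (f x)\<^sup>2) / x\<^sup>2) \<longlongrightarrow> 2 * a 2 - (a 1)\<^sup>2) (at_right 0)"
proof -
  define R where "R x = (\<Sum>k. a (k + 2) * x ^ k)" for x
  have summR: "summable (\<lambda>n. a (n + 2) * x ^ n)" for x
  proof (cases "x = 0")
    case False
    have "summable (\<lambda>n. a (n + 2) * x ^ (n + 2))"
      using summ[of x] by (rule summable_ignore_initial_segment)
    then have "summable (\<lambda>n. a (n + 2) * x ^ (n + 2) * (1 / x\<^sup>2))"
      by (rule summable_mult2)
    then show ?thesis using False by (simp add: power_add power2_eq_square)
  qed (simp add: powser_zero summable_finite[of "{0}"])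
  have f_eq: "f x = 1 + a 1 * x + x\<^sup>2 * R x" for x
  proof -
    have "f x = (\<Sum>k. a (k + 2) * x ^ (k + 2)) + (\<Sum>k<2. a k * x ^ k)"
      unfolding f_def by (rule suminf_split_initial_segment[OF summ])
    also have "(\<Sum>k. a (k + 2) * x ^ (k + 2)) = x\<^sup>2 * R x"
      unfolding R_def suminf_mult[OF summR, symmetric] by (simp add: power_add mult_ac power2_eq_square)
    finally show ?thesis using a0 by (simp add: eval_nat_numeral)
  qed
  have R0: "R 0 = a 2"
    unfolding R_def using powser_zero[of "\<lambda>k. a (k + 2)"] by (simp only: add_0)
  have contR: "isCont R x" for x
    unfolding R_def[abs_def] by (rule isCont_powser_converges_everywhere[OF summR])
  have id0: "((\<lambda>x. x) \<longlongrightarrow> 0) (at_right (0::real))" "((\<lambda>x. 2 * x) \<longlongrightarrow> 0) (at_right (0::real))"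
    by (auto intro!: tendsto_eq_intros)
  note lims = isCont_tendsto_compose[OF contR id0(1)] isCont_tendsto_compose[OF contR id0(2)]
  \<comment> \<open>After substituting \<open>f_eq\<close>, the constant and linear terms of f (2 *
    x) and (f x)^2 cancel; division by x^2 leaves this expression.\<close>
  have "((\<lambda>x. 4 * R (2 * x) - 2 * R x - (a 1 + x * R x)\<^sup>2) \<longlongrightarrow>
      4 * R 0 - 2 * R 0 - (a 1 + 0 * R 0)\<^sup>2) (at_right 0)"
    by (intro tendsto_intros lims)
  moreover have "\<forall>\<^sub>F x in at_right 0. 4 * R (2 * x) - 2 * R x - (a 1 + x * R x)\<^sup>2 =
      (f (2 * x) - (f x)\<^sup>2) / x\<^sup>2"
    using eventually_at_right_less[of 0]
    by eventually_elim (simp add: f_eq field_simps power2_eq_square)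
  ultimately show ?thesis
    using R0 by (auto dest: Lim_transform_eventually)
qed

subsection \<open>Bounds on the Gamma quotient and the function \<open>h\<close>\<close>

lemma Gamma_real_nonzero: "(y::real) > 0 \<Longrightarrow> Gamma y \<noteq> 0"
  using Gamma_real_pos[of y] by linarith

text \<open>Log-convexity of \<open>Gamma\<close>, in the form of increasing slopes. On an interval
  of length 1 the recurrence evaluates the slope as a logarithm.\<close>

lemma ln_Gamma_slopes:
  fixes x y z :: real
  assumes "0 < x" "x < y" "y < z"
  shows "(ln (Gamma y) - ln (Gamma x)) / (y - x) \<le> (ln (Gamma z) - ln (Gamma y)) / (z - y)"
proof -
  define g where "g = (ln \<circ> Gamma :: real \<Rightarrow> real)"
  have "convex_on {0<..} g"
    unfolding g_def by (rule log_convex_Gamma_real)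
  define l where "l = (y - x) / (z - x)"
  have l: "l * (z - x) = y - x" "0 \<le> l" "l \<le> 1"
    using assms by (simp_all add: l_def)
  have "y = (1 - l) * x + l * z"
    using l by (simp add: algebra_simps)
  then have "g y \<le> (1 - l) * g x + l * g z"
    using convex_onD[OF \<open>convex_on {0<..} g\<close>, of l x z] l assms by simp
  then have "(z - x) * g y \<le> (z - x) * ((1 - l) * g x + l * g z)"
    using assms by (intro mult_left_mono) auto
  also have "\<dots> = ((z - x) - l * (z - x)) * g x + l * (z - x) * g z"
    by (simp add: algebra_simps)
  finally have "(z - x) * g y \<le> (z - y) * g x + (y - x) * g z"
    by (simp add: l)
  then have "(g y - g x) / (y - x) \<le> (g z - g y) / (z - y)"
    using assms by (simp add: field_simps)
  then show ?thesis by (simp add: g_def)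
qed

lemma ln_Gamma_plus1: "(y::real) > 0 \<Longrightarrow> ln (Gamma (y + 1)) = ln y + ln (Gamma y)"
  using Gamma_plus1[of y] pos_notin_nonpos_Ints[of y] Gamma_real_nonzero[of y] by (simp add: ln_mult)

lemma ln_gamma_ratio:
  "a > 0 \<Longrightarrow> y > 0 \<Longrightarrow> ln (gamma_ratio a y) = ln (Gamma (y + a)) - ln (Gamma y)"
  using Gamma_real_nonzero[of y] Gamma_real_nonzero[of "y + a"] by (simp add: gamma_ratio_def ln_div)

text \<open>The slope of ln Gamma on [y - 1, y] is ln (y - 1), and it is at most the slope on
  [y, y + a]. The upper bound below uses [y + a, y + a + 1] instead; together they give growth of
  order y^a.\<close>

lemma gamma_ratio_ge:
  assumes "a > 0" "y > 1"
  shows "(y - 1) powr a \<le> gamma_ratio a y"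
proof -
  have "a * ln (y - 1) \<le> ln (gamma_ratio a y)"
    using ln_Gamma_slopes[of "y - 1" y "y + a"] ln_Gamma_plus1[of "y - 1"] assms
    by (simp add: ln_gamma_ratio field_simps)
  then have "exp (a * ln (y - 1)) \<le> exp (ln (gamma_ratio a y))"
    by (simp only: exp_le_cancel_iff)
  then show ?thesis
    using assms gamma_ratio_pos[of a y] by (simp add: powr_def)
qed

lemma gamma_ratio_le:
  assumes "a > 0" "y > 0"
  shows "gamma_ratio a y \<le> (y + a) powr a"
proof -
  have "ln (gamma_ratio a y) \<le> a * ln (y + a)"
    using ln_Gamma_slopes[of y "y + a" "y + a + 1"] ln_Gamma_plus1[of "y + a"] assms
    by (simp add: ln_gamma_ratio field_simps)
  then have "exp (ln (gamma_ratio a y)) \<le> exp (a * ln (y + a))"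
    by (simp only: exp_le_cancel_iff)
  then show ?thesis
    using assms gamma_ratio_pos[of a y] by (simp add: powr_def)
qed

text \<open>The equation defining \<open>h a\<close> says exactly that this quotient equals
  2.\<close>

lemma gamma_ratio_shift_quotient:
  assumes "a > 0" "y > 0"
  shows "gamma_ratio a (y + a) / gamma_ratio a y = Gamma y * Gamma (2 * a + y) / (Gamma (a + y))\<^sup>2"
proof -
  have "2 * a + y = y + a + a" "a + y = y + a" by simp_all
  then show ?thesis
    unfolding gamma_ratio_def by (simp only:) (simp add: power2_eq_square)
qed

text \<open>The logarithmic derivative is \<open>digamma_diff a (t + a) - digamma_diff a t\<close>.
  It is negative because \<open>digamma_diff a\<close> itself strictly decreases, its derivative
  being a difference of values of the decreasing trigamma function.\<close>

lemma gamma_ratio_shift_quotient_strict_antimono: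
  assumes "a > 0" "0 < x" "x < y"
  shows "gamma_ratio a (y + a) / gamma_ratio a y < gamma_ratio a (x + a) / gamma_ratio a x"
proof -
  define F where "F t = ln (gamma_ratio a (t + a)) - ln (gamma_ratio a t)" for t
  have "F y < F x"
  proof (rule DERIV_neg_imp_decreasing[OF \<open>x < y\<close>])
    fix t assume t: "x \<le> t" "t \<le> y"
    have D: "((\<lambda>t. ln (gamma_ratio a t)) has_real_derivative digamma_diff a t) (at t)" if "t > 0" for t
      using DERIV_ln_divide[THEN DERIV_chain2, OF _ DERIV_gamma_ratio[OF \<open>a > 0\<close> that]]
        gamma_ratio_pos[OF \<open>a > 0\<close> that] by simp
    have "t > 0" using t assms by simp
    then have "(F has_real_derivative digamma_diff a (t + a) - digamma_diff a t) (at t)"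
      unfolding F_def[abs_def] using D[of t] D[of "t + a"] assms by (intro DERIV_diff) (simp_all add: DERIV_shift)
    moreover have "digamma_diff a (t + a) < digamma_diff a t"
    proof (rule DERIV_neg_imp_decreasing[where f = "digamma_diff a"])
      fix s assume "t \<le> s" "s \<le> t + a"
      then have "s > 0" using \<open>t > 0\<close> by simp
      then show "\<exists>d. (digamma_diff a has_real_derivative d) (at s) \<and> d < 0"
        unfolding digamma_diff_def[abs_def] using assms Polygamma_1_diff_bounds(1)[of a s]
        by (intro exI[of _ "Polygamma 1 (s + a) - Polygamma 1 s"] conjI)
           (auto intro!: derivative_eq_intros pos_notin_nonpos_Ints)
    qed (use assms in simp)
    ultimately show "\<exists>d. (F has_real_derivative d) (at t) \<and> d < 0"
      by force
  qed
  then have "ln (gamma_ratio a (y + a) / gamma_ratio a y) < ln (gamma_ratio a (x + a) / gamma_ratio a x)"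
    unfolding F_def using gamma_ratio_pos[OF \<open>a > 0\<close>] assms by (simp add: ln_div less_imp_neq[symmetric])
  then show ?thesis
    using gamma_ratio_pos[OF \<open>a > 0\<close>] assms by (subst (asm) ln_less_cancel_iff) auto
qed

text \<open>Writing Gamma y = Gamma (y + 1) / y isolates the pole at 0; the remaining factor has a
  positive limit.\<close>

lemma gamma_ratio_shift_quotient_at_right_0:
  assumes "a > 0"
  shows "filterlim (\<lambda>y. gamma_ratio a (y + a) / gamma_ratio a y) at_top (at_right 0)"
proof -
  have cont: "isCont Gamma (1::real)" "isCont Gamma (2 * a)" "isCont Gamma a"
    using assms by (auto intro!: isCont_Gamma pos_notin_nonpos_Ints)
  have id0: "((\<lambda>y. y + 1) \<longlongrightarrow> 1) (at_right (0::real))"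
      "((\<lambda>y. 2 * a + y) \<longlongrightarrow> 2 * a) (at_right (0::real))" "((\<lambda>y. a + y) \<longlongrightarrow> a) (at_right (0::real))"
    by (auto intro!: tendsto_eq_intros)
  have pos: "Gamma a > 0" "Gamma (2 * a) > 0"
    using assms by simp_all
  have "((\<lambda>y. Gamma (y + 1) * Gamma (2 * a + y) / (Gamma (a + y))\<^sup>2) \<longlongrightarrow>
      Gamma 1 * Gamma (2 * a) / (Gamma a)\<^sup>2) (at_right 0)"
    using pos by (intro tendsto_intros isCont_tendsto_compose[OF cont(1) id0(1)]
      isCont_tendsto_compose[OF cont(2) id0(2)] isCont_tendsto_compose[OF cont(3) id0(3)]) auto
  moreover have "filterlim (\<lambda>y::real. 1 / y) at_top (at_right 0)"
    by real_asymp
  ultimately have "filterlim (\<lambda>y. Gamma (y + 1) * Gamma (2 * a + y) / (Gamma (a + y))\<^sup>2 * (1 / y)) at_top (at_right 0)"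
    by (intro filterlim_tendsto_pos_mult_at_top[where c = "Gamma 1 * Gamma (2 * a) / (Gamma a)\<^sup>2"])
       (use pos in auto)
  moreover have "\<forall>\<^sub>F y in at_right 0. Gamma (y + 1) * Gamma (2 * a + y) / (Gamma (a + y))\<^sup>2 * (1 / y) =
      gamma_ratio a (y + a) / gamma_ratio a y"
    using eventually_at_right_less[of 0]
  proof eventually_elim
    case (elim y)
    then show ?case
      using assms Gamma_plus1[of y] pos_notin_nonpos_Ints[of y] by (simp add: gamma_ratio_shift_quotient)
  qed
  ultimately show ?thesis
    by (auto elim: filterlim_cong[THEN iffD1, rotated 3])
qed

text \<open>The two power bounds dominate the quotient by ((y + 2a) / (y - 1))^a, which tends to
  1.\<close>

lemma gamma_ratio_shift_quotient_eventually_less_2: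
  assumes "a > 0"
  shows "\<forall>\<^sub>F y in at_top. gamma_ratio a (y + a) / gamma_ratio a y < 2"
proof -
  have "((\<lambda>y. ((y + 2 * a) / (y - 1)) powr a) \<longlongrightarrow> 1 powr a) at_top"
  proof (intro tendsto_powr tendsto_const)
    show "((\<lambda>y. (y + 2 * a) / (y - 1)) \<longlongrightarrow> 1) at_top"
      by real_asymp
  qed simp
  then have "\<forall>\<^sub>F y in at_top. ((y + 2 * a) / (y - 1)) powr a < 2"
    by (rule order_tendstoD) simp
  with eventually_gt_at_top[of 1] show ?thesis
  proof eventually_elim
    case (elim y)
    have "gamma_ratio a (y + a) / gamma_ratio a y \<le> (y + 2 * a) powr a / (y - 1) powr a"
      using gamma_ratio_le[of a "y + a"] gamma_ratio_ge[of a y] gamma_ratio_pos[of a] elim assms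
      by (intro frac_le) (auto simp: add_ac)
    then show ?case
      using elim assms by (simp add: powr_divide)
  qed
qed

text \<open>The quotient is at least 2 near 0 and below 2 far out, so the intermediate value theorem
  gives a solution. Strict monotonicity gives the uniqueness that \<open>THE\<close>
  requires.\<close>

lemma h_solution:
  assumes "a > 0"
  shows "h a > 0" "gamma_ratio a (h a + a) / gamma_ratio a (h a) = 2"
proof -
  define G where "G y = gamma_ratio a (y + a) / gamma_ratio a y" for y
  have antimono: "G y < G x" if "0 < x" "x < y" for x y
    unfolding G_def using gamma_ratio_shift_quotient_strict_antimono[OF assms that] .
  have equation: "2 * (Gamma (a + y))\<^sup>2 = Gamma y * Gamma (2 * a + y) \<longleftrightarrow> G y = 2" if "y > 0" for y
    using that assms Gamma_real_nonzero[of "a + y"] unfolding G_def gamma_ratio_shift_quotient[OF assms that]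
    by (subst divide_eq_eq) auto
  have "\<forall>\<^sub>F y in at_right 0. G y \<ge> 2 \<and> y > 0"
    using gamma_ratio_shift_quotient_at_right_0[OF assms] eventually_at_right_less[of 0]
    by (auto simp: G_def filterlim_at_top intro: eventually_conj)
  then obtain x where x: "G x \<ge> 2" "x > 0"
    using eventually_happens by fastforce
  have "\<forall>\<^sub>F y in at_top. G y < 2 \<and> y > x"
    using gamma_ratio_shift_quotient_eventually_less_2[OF assms] eventually_gt_at_top[of x]
    by (auto simp: G_def intro: eventually_conj)
  then obtain z where z: "G z < 2" "z > x"
    using eventually_happens by fastforce
  have contr: "isCont (gamma_ratio a) y" if "y > 0" for y
    using DERIV_gamma_ratio[OF assms that] by (rule DERIV_isCont)
  have "isCont G y" if "y > 0" for y
    unfolding G_def[abs_def] using that assms contr[of y] gamma_ratio_pos[of a y]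
    by (intro continuous_intros isCont_o2[OF _ contr]) auto
  then have "\<exists>y\<ge>x. y \<le> z \<and> G y = 2"
    using x z by (intro IVT2) auto
  then obtain y where y: "y > 0" "G y = 2"
    using x(2) by (meson less_le_trans)
  have "h a = y"
    unfolding h_def
  proof (rule the_equality)
    show "y' = y" if "0 < y' \<and> 2 * (Gamma (a + y'))\<^sup>2 = Gamma y' * Gamma (2 * a + y')" for y'
      using antimono[of y y'] antimono[of y' y] y that equation[of y'] by (cases y y' rule: linorder_cases) auto
  qed (use y equation in auto)
  with y show "h a > 0" "gamma_ratio a (h a + a) / gamma_ratio a (h a) = 2"
    by (simp_all add: G_def)
qed

text \<open>The quotient strictly decreases through the value 2 at \<open>h a\<close>. The
  right-hand sides are the forms in which the condition on \<open>b\<close> enters: as the start of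
  the concave or convex sequence, and as the sign of the x^2-coefficient.\<close>

lemma h_le_iff:
  assumes "a > 0" "b > 0"
  shows "h a \<le> b \<longleftrightarrow> gamma_ratio a (b + a) \<le> 2 * gamma_ratio a b"
    and "b \<le> h a \<longleftrightarrow> 2 * gamma_ratio a b \<le> gamma_ratio a (b + a)"
proof -
  note anti = gamma_ratio_shift_quotient_strict_antimono[OF assms(1)]
  have "h a \<le> b \<longleftrightarrow> gamma_ratio a (b + a) / gamma_ratio a b \<le> 2"
    using h_solution[OF assms(1)] anti[of b "h a"] anti[of "h a" b] assms(2)
    by (cases b "h a" rule: linorder_cases) auto
  moreover have "b \<le> h a \<longleftrightarrow> 2 \<le> gamma_ratio a (b + a) / gamma_ratio a b"
    using h_solution[OF assms(1)] anti[of b "h a"] anti[of "h a" b] assms(2)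
    by (cases b "h a" rule: linorder_cases) auto
  ultimately show "h a \<le> b \<longleftrightarrow> gamma_ratio a (b + a) \<le> 2 * gamma_ratio a b"
      "b \<le> h a \<longleftrightarrow> 2 * gamma_ratio a b \<le> gamma_ratio a (b + a)"
    using gamma_ratio_pos[OF assms] by (simp_all add: field_simps)
qed

subsection \<open>The Mittag-Leffler function\<close>

definition ml_coeff :: "real \<Rightarrow> real \<Rightarrow> nat \<Rightarrow> real" where
  "ml_coeff a b k = 1 / Gamma (a * real k + b)"

lemma mittag_leffler_eq: "mittag_leffler a b (x::real) = (\<Sum>k. ml_coeff a b k * x ^ k)"
  by (simp add: mittag_leffler_def ml_coeff_def)

lemma ml_coeff_pos: "a > 0 \<Longrightarrow> b > 0 \<Longrightarrow> ml_coeff a b k > 0"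
  by (simp add: ml_coeff_def add_nonneg_pos)

lemma ml_coeff_Suc:
  assumes "a > 0" "b > 0"
  shows "ml_coeff a b (Suc k) = ml_coeff a b k / gamma_ratio a (a * real k + b)"
proof -
  have "a * real k + b > 0"
    using assms by (simp add: add_nonneg_pos)
  moreover have eq: "a * real (Suc k) + b = a * real k + b + a"
    by (simp add: algebra_simps)
  ultimately show ?thesis
    using Gamma_real_nonzero unfolding ml_coeff_def gamma_ratio_def eq by simp
qed

lemma gamma_ratio_mult_ml_coeff:
  assumes "a > 0" "b > 0"
  shows "gamma_ratio a (a * real k + b) * ml_coeff a b (Suc k) = ml_coeff a b k"
  using ml_coeff_Suc[OF assms, of k] gamma_ratio_pos[of a "a * real k + b"] assms
  by (simp add: add_nonneg_pos less_imp_neq[symmetric])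

lemma gamma_ratio_at_top:
  assumes "a > 0"
  shows "filterlim (gamma_ratio a) at_top at_top"
proof (rule filterlim_at_top_mono)
  show "filterlim (\<lambda>y. (y - 1) powr a) at_top at_top"
    using assms by real_asymp
  show "\<forall>\<^sub>F y in at_top. (y - 1) powr a \<le> gamma_ratio a y"
    using eventually_gt_at_top[of 1] by eventually_elim (rule gamma_ratio_ge[OF assms])
qed

lemma ml_argument_at_top:
  "a > 0 \<Longrightarrow> filterlim (\<lambda>k. a * real k + b) at_top sequentially"
  by real_asymp

lemma summable_ml:
  fixes x :: real
  assumes "a > 0" "b > 0"
  shows "summable (\<lambda>k. ml_coeff a b k * x ^ k)"
proof -
  \<comment> \<open>Successive terms have absolute ratio |x| divided by the Gamma quotient, so this
    threshold makes them at least halve.\<close>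
  have "\<forall>\<^sub>F k in sequentially. gamma_ratio a (a * real k + b) \<ge> 2 * \<bar>x\<bar> + 1"
    using filterlim_compose[OF gamma_ratio_at_top ml_argument_at_top, OF assms(1) assms(1)]
    by (auto simp: filterlim_at_top)
  then obtain N where N: "gamma_ratio a (a * real k + b) \<ge> 2 * \<bar>x\<bar> + 1" if "k \<ge> N" for k
    by (auto simp: eventually_at_top_linorder)
  show ?thesis
  proof (rule summable_ratio_test[of "1 / 2" N])
    fix k assume "N \<le> k"
    have c: "ml_coeff a b k > 0" by (rule ml_coeff_pos[OF assms])
    have "\<bar>x\<bar> / gamma_ratio a (a * real k + b) \<le> 1 / 2"
      using N[OF \<open>N \<le> k\<close>] by (simp add: field_simps)
    then have "\<bar>x\<bar> / gamma_ratio a (a * real k + b) * (ml_coeff a b k * \<bar>x\<bar> ^ k) \<le>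
        1 / 2 * (ml_coeff a b k * \<bar>x\<bar> ^ k)"
      using c by (intro mult_right_mono) auto
    then show "norm (ml_coeff a b (Suc k) * x ^ Suc k) \<le> 1 / 2 * norm (ml_coeff a b k * x ^ k)"
      using c gamma_ratio_pos[of a "a * real k + b"] assms
      by (simp add: ml_coeff_Suc abs_mult power_abs add_nonneg_pos mult_ac)
  qed simp
qed

lemma DERIV_mittag_leffler:
  assumes "a > 0" "b > 0"
  shows "(mittag_leffler a b has_real_derivative (\<Sum>k. diffs (ml_coeff a b) k * x ^ k)) (at (x::real))"
  unfolding mittag_leffler_eq[abs_def]
  by (rule termdiffs_strong_converges_everywhere[OF summable_ml[OF assms]])

lemma summable_diffs_ml:
  fixes x :: real
  assumes "a > 0" "b > 0"
  shows "summable (\<lambda>k. diffs (ml_coeff a b) k * x ^ k)"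
  by (rule termdiff_converges_all[OF summable_ml[OF assms]])

lemma mittag_leffler_ge:
  assumes "a > 0" "b > 0" "x \<ge> 0"
  shows "ml_coeff a b 0 + ml_coeff a b 1 * x \<le> mittag_leffler a b x"
proof -
  have "(\<Sum>k<2. ml_coeff a b k * x ^ k) \<le> (\<Sum>k. ml_coeff a b k * x ^ k)"
    using assms ml_coeff_pos[OF assms(1,2)]
    by (intro sum_le_suminf summable_ml) (auto simp: less_imp_le)
  then show ?thesis by (simp add: mittag_leffler_eq eval_nat_numeral)
qed

lemma mittag_leffler_pos:
  assumes "a > 0" "b > 0" "x \<ge> 0"
  shows "mittag_leffler a b (x::real) > 0"
proof -
  have "ml_coeff a b 1 * x \<ge> 0"
    using ml_coeff_pos[OF assms(1,2), of 1] assms(3) by simp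
  then show ?thesis
    using mittag_leffler_ge[OF assms] ml_coeff_pos[OF assms(1,2), of 0] by linarith
qed

lemma mittag_leffler_0: "a > 0 \<Longrightarrow> b > 0 \<Longrightarrow> mittag_leffler a b (0::real) = 1 / Gamma b"
  using powser_zero[of "ml_coeff a b"] by (simp add: mittag_leffler_eq ml_coeff_def)

lemma ml_normalized_eq_divide:
  "a > 0 \<Longrightarrow> b > 0 \<Longrightarrow> mittag_leffler_normalized a b x = mittag_leffler a b x / mittag_leffler a b 0"
  by (simp add: mittag_leffler_normalized_def mittag_leffler_0)

lemma ml_normalized_pos: "a > 0 \<Longrightarrow> b > 0 \<Longrightarrow> x \<ge> 0 \<Longrightarrow> mittag_leffler_normalized a b x > 0"
  by (simp add: ml_normalized_eq_divide mittag_leffler_pos)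

text \<open>This value is the base of the geometric bounds at the integers in the growth
  arguments.\<close>

lemma ml_normalized_1_gt_1:
  assumes "a > 0" "b > 0"
  shows "mittag_leffler_normalized a b 1 > 1"
proof -
  have "mittag_leffler a b 0 = ml_coeff a b 0"
    using assms by (simp add: mittag_leffler_0 ml_coeff_def)
  then have "mittag_leffler a b 1 > mittag_leffler a b (0::real)"
    using mittag_leffler_ge[OF assms, of 1] ml_coeff_pos[OF assms, of 1] by linarith
  then show ?thesis
    using mittag_leffler_pos[OF assms, of 0] assms by (simp add: ml_normalized_eq_divide)
qed

lemma DERIV_ln_mittag_leffler:
  assumes "a > 0" "b > 0" "x \<ge> 0"
  shows "((\<lambda>x. ln (mittag_leffler a b x)) has_real_derivative
    (\<Sum>k. diffs (ml_coeff a b) k * x ^ k) / mittag_leffler a b x) (at (x::real))"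
  using DERIV_ln_divide[THEN DERIV_chain2, OF _ DERIV_mittag_leffler[OF assms(1,2)]]
    mittag_leffler_pos[OF assms] by simp

lemma isCont_ln_mittag_leffler:
  "a > 0 \<Longrightarrow> b > 0 \<Longrightarrow> x \<ge> 0 \<Longrightarrow> isCont (\<lambda>x. ln (mittag_leffler a b x)) (x::real)"
  by (rule DERIV_isCont[OF DERIV_ln_mittag_leffler])

lemma ln_ml_normalized:
  assumes "a > 0" "b > 0" "x \<ge> 0"
  shows "ln (mittag_leffler_normalized a b x) = ln (mittag_leffler a b x) - ln (mittag_leffler a b 0)"
  unfolding ml_normalized_eq_divide[OF assms(1,2)]
  by (rule ln_divide_pos) (use mittag_leffler_pos assms in auto)

lemma ln_ml_normalized_mult:
  assumes "a > 0" "b > 0" "z \<ge> 0" "s \<ge> 0"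
  shows "ln (mittag_leffler_normalized a b z * mittag_leffler_normalized a b s) =
    ln (mittag_leffler a b z) + ln (mittag_leffler a b s) - 2 * ln (mittag_leffler a b 0)"
  using ln_mult_pos[OF ml_normalized_pos[OF assms(1-3)] ml_normalized_pos[OF assms(1,2,4)]]
    ln_ml_normalized[OF assms(1-3)] ln_ml_normalized[OF assms(1,2,4)] by linarith

text \<open>For g = ln E the claim reads g z + g s \<le> g (z + s) + g 0: the normalization
  contributes g 0 twice on the left and once on the right.\<close>

lemma log_convex_imp_super_additive_ml:
  assumes "a > 0" "b > 0" "log_convex_on {0<..} (mittag_leffler a b)"
  shows "mult_super_additive_on {0<..} (mittag_leffler_normalized a b)"
  unfolding mult_super_additive_on_def
proof (intro ballI)
  fix z s :: real assume "z \<in> {0<..}" "s \<in> {0<..}"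
  then have zs: "z > 0" "s > 0" "z \<ge> 0" "s \<ge> 0" "z + s \<ge> 0" by simp_all
  have "ln (mittag_leffler a b z) + ln (mittag_leffler a b s) \<le>
      ln (mittag_leffler a b (z + s)) + ln (mittag_leffler a b 0)"
    by (rule convex_on_imp_super_additive[OF assms(3)[unfolded log_convex_on_def]
          isCont_ln_mittag_leffler[OF assms(1,2)] zs(1,2)])
  then have "ln (mittag_leffler_normalized a b z * mittag_leffler_normalized a b s) \<le>
      ln (mittag_leffler_normalized a b (z + s))"
    unfolding ln_ml_normalized_mult[OF assms(1,2) zs(3,4)] ln_ml_normalized[OF assms(1,2) zs(5)]
    by linarith
  then show "mittag_leffler_normalized a b z * mittag_leffler_normalized a b s \<le>
      mittag_leffler_normalized a b (z + s)"
    by (rule ln_le_cancel_iff[THEN iffD1, rotated 2])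
       (use zs assms in \<open>auto intro!: mult_pos_pos ml_normalized_pos\<close>)
qed

lemma log_concave_imp_sub_additive_ml:
  assumes "a > 0" "b > 0" "log_concave_on {0<..} (mittag_leffler a b)"
  shows "mult_sub_additive_on {0<..} (mittag_leffler_normalized a b)"
  unfolding mult_sub_additive_on_def
proof (intro ballI)
  fix z s :: real assume "z \<in> {0<..}" "s \<in> {0<..}"
  then have zs: "z > 0" "s > 0" "z \<ge> 0" "s \<ge> 0" "z + s \<ge> 0" by simp_all
  have "- ln (mittag_leffler a b z) + - ln (mittag_leffler a b s) \<le>
      - ln (mittag_leffler a b (z + s)) + - ln (mittag_leffler a b 0)"
    by (rule convex_on_imp_super_additive[OF assms(3)[unfolded log_concave_on_def concave_on_def]
          isCont_minus[OF isCont_ln_mittag_leffler[OF assms(1,2)]] zs(1,2)])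
  then have "ln (mittag_leffler_normalized a b (z + s)) \<le>
      ln (mittag_leffler_normalized a b z * mittag_leffler_normalized a b s)"
    unfolding ln_ml_normalized_mult[OF assms(1,2) zs(3,4)] ln_ml_normalized[OF assms(1,2) zs(5)]
    by linarith
  then show "mittag_leffler_normalized a b (z + s) \<le>
      mittag_leffler_normalized a b z * mittag_leffler_normalized a b s"
    by (rule ln_le_cancel_iff[THEN iffD1, rotated 2])
       (use zs assms in \<open>auto intro!: mult_pos_pos ml_normalized_pos\<close>)
qed

section \<open>Sufficiency of the conditions on the parameters\<close>

lemma diffs_ml_coeff:
  assumes "a > 0" "b > 0"
  shows "diffs (ml_coeff a b) k = real (Suc k) / gamma_ratio a (a * real k + b) * ml_coeff a b k"
  using ml_coeff_Suc[OF assms, of k] by (simp add: diffs_def)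

text \<open>
  The condition on \<open>h\<close> says that the concave sequence \<open>\<lambda>k. gamma_ratio a (a * k + b)\<close> stays concave
  when extended by 0 at \<open>k = -1\<close>; hence its quotient by \<open>k + 1\<close> is decreasing.
\<close>

lemma ml_coeff_ratio_mono:
  assumes "0 < a" "a \<le> 1" "b > 0" "h a \<le> b"
  shows "mono (\<lambda>k. real (Suc k) / gamma_ratio a (a * real k + b))"
proof (rule monoI, rule lift_Suc_mono_le[of "\<lambda>k. real (Suc k) / gamma_ratio a (a * real k + b)"])
  fix k
  define p where "p k = gamma_ratio a (a * real k + b)" for k
  have p: "p k > 0" for k
    unfolding p_def using assms by (intro gamma_ratio_pos) (auto intro: add_nonneg_pos)
  have "real (k + 1) * p (k + 1) \<le> real (k + 2) * p k"
  proof (rule concave_seq_ratio_antimono)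
    fix k
    have pos: "a * real n + b > 0" for n
      using assms by (auto intro: add_nonneg_pos)
    have "(1 - 1/2) * (a * real k + b) + 1/2 * (a * real (k + 2) + b) = a * real (k + 1) + b"
      by (simp add: algebra_simps)
    then show "p k + p (k + 2) \<le> 2 * p (k + 1)"
      using concave_onD[OF concave_on_gamma_ratio[OF assms(1,2)], of "1/2" "a * real k + b" "a * real (k + 2) + b"]
        pos[of k] pos[of "k + 2"] by (simp add: p_def)
    show "p 1 \<le> 2 * p 0"
      using h_le_iff(1)[OF assms(1,3)] assms(4) by (simp add: p_def add_ac)
  qed
  then show "real (Suc k) / gamma_ratio a (a * real k + b) \<le> real (Suc (Suc k)) / gamma_ratio a (a * real (Suc k) + b)"
    using p[of k] p[of "Suc k"] unfolding p_def by (simp add: frac_le_eq divide_le_eq field_simps)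
qed

lemma ml_coeff_ratio_antimono:
  assumes "a \<ge> 1" "b > 0" "b \<le> h a"
  shows "antimono (\<lambda>k. real (Suc k) / gamma_ratio a (a * real k + b))"
proof (rule antimonoI, rule lift_Suc_antimono_le[of "\<lambda>k. real (Suc k) / gamma_ratio a (a * real k + b)"])
  fix k
  have "a > 0" using assms by simp
  define p where "p k = gamma_ratio a (a * real k + b)" for k
  have p: "p k > 0" for k
    unfolding p_def using assms by (intro gamma_ratio_pos) (auto intro: add_nonneg_pos)
  \<comment> \<open>The sequence is now convex, so the lemma on concave sequences is applied to its
    negative.\<close>
  have "real (k + 1) * - p (k + 1) \<le> real (k + 2) * - p k"
  proof (rule concave_seq_ratio_antimono)
    fix k
    have pos: "a * real n + b > 0" for n
      using assms by (auto intro: add_nonneg_pos)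
    have "(1 - 1/2) * (a * real k + b) + 1/2 * (a * real (k + 2) + b) = a * real (k + 1) + b"
      by (simp add: algebra_simps)
    then show "- p k + - p (k + 2) \<le> 2 * - p (k + 1)"
      using convex_onD[OF convex_on_gamma_ratio[OF assms(1)], of "1/2" "a * real k + b" "a * real (k + 2) + b"]
        pos[of k] pos[of "k + 2"] by (simp add: p_def)
    show "- p 1 \<le> 2 * - p 0"
      using h_le_iff(2)[OF \<open>a > 0\<close> assms(2)] assms(3) by (simp add: p_def add_ac)
  qed
  then show "real (Suc (Suc k)) / gamma_ratio a (a * real (Suc k) + b) \<le> real (Suc k) / gamma_ratio a (a * real k + b)"
    using p[of k] p[of "Suc k"] unfolding p_def by (simp add: frac_le_eq divide_le_eq field_simps)
qed

text \<open>The derivative of ln E is a quotient of power series with coefficients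
  \<open>diffs (ml_coeff a b)\<close> and \<open>ml_coeff a b\<close>. The quotient of these
  coefficients increases, hence so does the quotient of the series.\<close>

lemma log_convex_on_ml:
  assumes "0 < a" "a \<le> 1" "b > 0" "h a \<le> b"
  shows "log_convex_on {0<..} (mittag_leffler a b)"
  unfolding log_convex_on_def
proof (rule convex_on_realI)
  fix x y :: real assume xy: "x \<in> {0<..}" "y \<in> {0<..}" "x \<le> y"
  have "diffs (ml_coeff a b) j * ml_coeff a b k \<le> diffs (ml_coeff a b) k * ml_coeff a b j" if "j \<le> k" for j k
  proof -
    have "real (Suc j) / gamma_ratio a (a * real j + b) * (ml_coeff a b j * ml_coeff a b k) \<le>
        real (Suc k) / gamma_ratio a (a * real k + b) * (ml_coeff a b j * ml_coeff a b k)"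
      using monoD[OF ml_coeff_ratio_mono[OF assms] that] ml_coeff_pos[OF assms(1,3)]
      by (intro mult_right_mono) (auto intro: less_imp_le)
    then show ?thesis
      by (simp only: diffs_ml_coeff[OF assms(1,3)] mult_ac)
  qed
  from power_series_ratio_mono[OF this _ _ summable_diffs_ml[OF assms(1,3)] summable_ml[OF assms(1,3)], of x y] xy
  show "(\<Sum>k. diffs (ml_coeff a b) k * x ^ k) / mittag_leffler a b x \<le>
      (\<Sum>k. diffs (ml_coeff a b) k * y ^ k) / mittag_leffler a b y"
    using mittag_leffler_pos[OF assms(1,3), of x] mittag_leffler_pos[OF assms(1,3), of y]
    by (intro frac_le_eq[THEN iffD2] divide_nonpos_pos) (auto simp: mittag_leffler_eq less_imp_neq[symmetric])
next
  fix x :: real assume "x \<in> {0<..}"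
  then show "((\<lambda>x. ln (mittag_leffler a b x)) has_real_derivative
      (\<Sum>k. diffs (ml_coeff a b) k * x ^ k) / mittag_leffler a b x) (at x)"
    using assms by (intro DERIV_ln_mittag_leffler) auto
qed simp

lemma log_concave_on_ml:
  assumes "a \<ge> 1" "b > 0" "b \<le> h a"
  shows "log_concave_on {0<..} (mittag_leffler a b)"
  unfolding log_concave_on_def concave_on_def
proof (rule convex_on_realI)
  have "a > 0" using assms by simp
  fix x y :: real assume xy: "x \<in> {0<..}" "y \<in> {0<..}" "x \<le> y"
  \<comment> \<open>Numerator and denominator are exchanged: the comparison of series now yields
    that E/E' increases, in product form.\<close>
  have "ml_coeff a b j * diffs (ml_coeff a b) k \<le> ml_coeff a b k * diffs (ml_coeff a b) j" if "j \<le> k" for j k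
  proof -
    have "real (Suc k) / gamma_ratio a (a * real k + b) * (ml_coeff a b j * ml_coeff a b k) \<le>
        real (Suc j) / gamma_ratio a (a * real j + b) * (ml_coeff a b j * ml_coeff a b k)"
      using antimonoD[OF ml_coeff_ratio_antimono[OF assms] that] ml_coeff_pos[OF \<open>a > 0\<close> assms(2)]
      by (intro mult_right_mono) (auto intro: less_imp_le)
    then show ?thesis
      by (simp only: diffs_ml_coeff[OF \<open>a > 0\<close> assms(2)] mult_ac)
  qed
  from power_series_ratio_mono[OF this _ _ summable_ml[OF \<open>a > 0\<close> assms(2)] summable_diffs_ml[OF \<open>a > 0\<close> assms(2)], of x y] xy
  have "(\<Sum>k. diffs (ml_coeff a b) k * y ^ k) / mittag_leffler a b y \<le>
      (\<Sum>k. diffs (ml_coeff a b) k * x ^ k) / mittag_leffler a b x"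
    using mittag_leffler_pos[OF \<open>a > 0\<close> assms(2), of x] mittag_leffler_pos[OF \<open>a > 0\<close> assms(2), of y]
    by (intro frac_le_eq[THEN iffD2] divide_nonpos_pos) (auto simp: mittag_leffler_eq less_imp_neq[symmetric] mult_ac)
  then show "- ((\<Sum>k. diffs (ml_coeff a b) k * x ^ k) / mittag_leffler a b x) \<le>
      - ((\<Sum>k. diffs (ml_coeff a b) k * y ^ k) / mittag_leffler a b y)"
    by simp
next
  fix x :: real assume "x \<in> {0<..}"
  then show "((\<lambda>x. - ln (mittag_leffler a b x)) has_real_derivative
      - ((\<Sum>k. diffs (ml_coeff a b) k * x ^ k) / mittag_leffler a b x)) (at x)"
    using assms by (intro DERIV_minus DERIV_ln_mittag_leffler) auto
qed simp

section \<open>Necessity of the conditions on the parameters\<close>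

lemma ml_normalized_square_defect:
  assumes "a > 0" "b > 0"
  shows "\<exists>c > 0. ((\<lambda>x. (mittag_leffler_normalized a b (x + x) -
      mittag_leffler_normalized a b x * mittag_leffler_normalized a b x) / x\<^sup>2) \<longlongrightarrow>
    c * (2 * gamma_ratio a b - gamma_ratio a (b + a))) (at_right 0)"
proof -
  define d where "d k = Gamma b * ml_coeff a b k" for k
  have f: "mittag_leffler_normalized a b x = (\<Sum>k. d k * x ^ k)" for x
    unfolding mittag_leffler_normalized_def mittag_leffler_eq d_def
    by (simp add: suminf_mult[OF summable_ml[OF assms], symmetric] mult.assoc)
  have summ: "summable (\<lambda>k. d k * x ^ k)" for x
    using summable_mult[OF summable_ml[OF assms], of "Gamma b" x] by (simp add: d_def mult.assoc)
  have d0: "d 0 = 1"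
    using assms Gamma_real_nonzero[of b] by (simp add: d_def ml_coeff_def)
  have d1: "d 1 = 1 / gamma_ratio a b"
    using d0 ml_coeff_Suc[OF assms, of 0] by (simp add: d_def)
  have d2: "d 2 = d 1 / gamma_ratio a (b + a)"
    using ml_coeff_Suc[OF assms, of 1] by (simp add: d_def eval_nat_numeral add_ac)
  have pos: "gamma_ratio a b > 0" "gamma_ratio a (b + a) > 0"
    using assms gamma_ratio_pos by auto
  \<comment> \<open>With P = \<open>gamma_ratio a\<close>, d 1 = 1 / P b and d 2 = 1 / (P b * P (b +
    a)); \<open>c\<close> is the positive common factor of 2 * d 2 - (d 1)^2.\<close>
  define c where "c = 1 / ((gamma_ratio a b)\<^sup>2 * gamma_ratio a (b + a))"
  have "2 * d 2 - (d 1)\<^sup>2 = c * (2 * gamma_ratio a b - gamma_ratio a (b + a))"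
    unfolding d2 d1 c_def using pos by (simp add: field_simps power2_eq_square)
  moreover have "c > 0"
    using pos by (simp add: c_def)
  moreover note power_series_square_defect_tendsto[OF summ d0, folded f, unfolded mult_2
      power2_eq_square[of "mittag_leffler_normalized a b _"]]
  ultimately show ?thesis
    by (intro exI[of _ c] conjI) (simp_all only: mult_2)
qed

text \<open>Taking z = s = x makes the defect nonnegative for all x > 0, and its limit after
  division by x^2 has the sign of the condition on \<open>h\<close>.\<close>

lemma super_additive_ml_imp_h_le:
  assumes "a > 0" "b > 0" "mult_super_additive_on {0<..} (mittag_leffler_normalized a b)"
  shows "h a \<le> b"
proof -
  obtain c where c: "c > 0" "((\<lambda>x. (mittag_leffler_normalized a b (x + x) -
      mittag_leffler_normalized a b x * mittag_leffler_normalized a b x) / x\<^sup>2) \<longlongrightarrow>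
    c * (2 * gamma_ratio a b - gamma_ratio a (b + a))) (at_right 0)"
    using ml_normalized_square_defect[OF assms(1,2)] by blast
  have "0 \<le> c * (2 * gamma_ratio a b - gamma_ratio a (b + a))"
  proof (rule tendsto_lowerbound[OF c(2)])
    show "\<forall>\<^sub>F x in at_right 0. 0 \<le> (mittag_leffler_normalized a b (x + x) -
      mittag_leffler_normalized a b x * mittag_leffler_normalized a b x) / x\<^sup>2"
      using eventually_at_right_less[of 0]
    proof eventually_elim
      case (elim x)
      have "mittag_leffler_normalized a b x * mittag_leffler_normalized a b x \<le> mittag_leffler_normalized a b (x + x)"
        using assms(3) elim unfolding mult_super_additive_on_def by blast
      then show ?case by simp
    qed
  qed simp
  then show ?thesis
    using c(1) h_le_iff(1)[OF assms(1,2)] by (simp add: zero_le_mult_iff)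
qed

lemma sub_additive_ml_imp_le_h:
  assumes "a > 0" "b > 0" "mult_sub_additive_on {0<..} (mittag_leffler_normalized a b)"
  shows "b \<le> h a"
proof -
  obtain c where c: "c > 0" "((\<lambda>x. (mittag_leffler_normalized a b (x + x) -
      mittag_leffler_normalized a b x * mittag_leffler_normalized a b x) / x\<^sup>2) \<longlongrightarrow>
    c * (2 * gamma_ratio a b - gamma_ratio a (b + a))) (at_right 0)"
    using ml_normalized_square_defect[OF assms(1,2)] by blast
  have "c * (2 * gamma_ratio a b - gamma_ratio a (b + a)) \<le> 0"
  proof (rule tendsto_upperbound[OF c(2)])
    show "\<forall>\<^sub>F x in at_right 0. (mittag_leffler_normalized a b (x + x) -
      mittag_leffler_normalized a b x * mittag_leffler_normalized a b x) / x\<^sup>2 \<le> 0"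
      using eventually_at_right_less[of 0]
    proof eventually_elim
      case (elim x)
      have "mittag_leffler_normalized a b (x + x) \<le> mittag_leffler_normalized a b x * mittag_leffler_normalized a b x"
        using assms(3) elim unfolding mult_sub_additive_on_def by blast
      then show ?case by (simp add: divide_le_0_iff)
    qed
  qed simp
  then show ?thesis
    using c(1) h_le_iff(2)[OF assms(1,2)] by (simp add: mult_le_0_iff)
qed

text \<open>Super-additivity forces f (n + 1) \<ge> (f 1)^(n + 1). If a > 1, the Gamma quotients
  grow faster than k, so E is O(exp (M * x)) for every M > 0, in particular for a rate too small for
  this.\<close>

lemma super_additive_ml_imp_le_1:
  assumes "a > 0" "b > 0" "mult_super_additive_on {0<..} (mittag_leffler_normalized a b)"
  shows "a \<le> 1"
proof (rule ccontr)
  assume "\<not> a \<le> 1"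
  then have "a > 1" by simp
  define f where "f = mittag_leffler_normalized a b"
  have f1: "f 1 > 1"
    unfolding f_def by (rule ml_normalized_1_gt_1[OF assms(1,2)])
  \<comment> \<open>The induction starts at argument 1, since super-additivity is given only for
    positive arguments.\<close>
  have power: "f 1 ^ Suc n \<le> f (real (Suc n))" for n
  proof (induction n)
    case (Suc n)
    have "f 1 ^ Suc (Suc n) \<le> f (real (Suc n)) * f 1"
      using Suc f1 by simp
    also have "\<dots> \<le> f (real (Suc n) + 1)"
      unfolding f_def by (intro assms(3)[unfolded mult_super_additive_on_def, rule_format]) auto
    finally show ?case by (simp add: add_ac)
  qed simp
  \<comment> \<open>Half the forced rate, so that exp M is the square root of f 1.\<close>
  define M where "M = ln (f 1) / 2"
  have "M > 0" using f1 by (simp add: M_def)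
  have "filterlim (\<lambda>k. (a * real k + b - 1) powr a / real (Suc k)) at_top sequentially"
    using \<open>a > 1\<close> by real_asymp
  then have "\<forall>\<^sub>F k in sequentially. (a * real k + b - 1) powr a / real (Suc k) \<ge> 1 / M"
    by (auto simp: filterlim_at_top)
  moreover have "\<forall>\<^sub>F k in sequentially. a * real k + b > 1"
    using ml_argument_at_top[OF assms(1)] by (auto simp: filterlim_at_top_dense)
  ultimately have "\<forall>\<^sub>F k in sequentially. real (Suc k) * ml_coeff a b (Suc k) \<le> M * ml_coeff a b k"
  proof eventually_elim
    case (elim k)
    have "1 / M * real (Suc k) \<le> gamma_ratio a (a * real k + b)"
      using elim gamma_ratio_ge[OF assms(1), of "a * real k + b"] by (simp add: field_simps)
    then have "real (Suc k) * ml_coeff a b (Suc k) \<le> M * gamma_ratio a (a * real k + b) * ml_coeff a b (Suc k)"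
      using \<open>M > 0\<close> ml_coeff_pos[OF assms(1,2), of "Suc k"]
      by (intro mult_right_mono) (auto simp: field_simps)
    then show ?case
      by (simp add: gamma_ratio_mult_ml_coeff[OF assms(1,2)] mult.assoc)
  qed
  from power_series_le_exp[OF ml_coeff_pos[OF assms(1,2)] \<open>M > 0\<close> summable_ml[OF assms(1,2)] this]
  obtain K where K: "K > 0" "\<And>x. x \<ge> 0 \<Longrightarrow> mittag_leffler a b x \<le> K * exp (M * x)"
    unfolding mittag_leffler_eq by blast
  \<comment> \<open>Cancelling one factor exp M ^ Suc n from the two growth bounds leaves a bounded
    geometric sequence with base above 1.\<close>
  have "exp M ^ Suc n \<le> Gamma b * K" for n
  proof -
    have "exp M * exp M = f 1"
      using f1 unfolding exp_add[symmetric] by (simp add: M_def)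
    then have "exp M ^ Suc n * exp M ^ Suc n = f 1 ^ Suc n"
      by (simp only: power_mult_distrib[symmetric])
    also have "\<dots> \<le> Gamma b * (K * exp (M * real (Suc n)))"
      using power[of n] mult_left_mono[OF K(2)[of "real (Suc n)"], of "Gamma b"] assms(2)
      by (simp add: f_def mittag_leffler_normalized_def)
    also have "exp (M * real (Suc n)) = exp M ^ Suc n"
      by (rule exp_of_nat2_mult)
    finally show ?thesis
      by (simp add: mult.assoc[symmetric] del: power_Suc)
  qed
  moreover obtain n where "Gamma b * K < exp M ^ n"
    using real_arch_pow[of "exp M"] \<open>M > 0\<close> by auto
  moreover have "exp M ^ n \<le> exp M ^ Suc n"
    using \<open>M > 0\<close> by (intro power_increasing) auto
  ultimately show False
    by (meson leD le_less_trans less_le_trans)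
qed

text \<open>Dually, f (n + 1) \<le> (f 1)^(n + 1), while for a < 1 the Gamma quotients grow more
  slowly than k and E exceeds a positive multiple of exp (M * x) for every M > 0.\<close>

lemma sub_additive_ml_imp_ge_1:
  assumes "a > 0" "b > 0" "mult_sub_additive_on {0<..} (mittag_leffler_normalized a b)"
  shows "a \<ge> 1"
proof (rule ccontr)
  assume "\<not> a \<ge> 1"
  then have "a < 1" by simp
  define f where "f = mittag_leffler_normalized a b"
  have f1: "f 1 > 1"
    unfolding f_def by (rule ml_normalized_1_gt_1[OF assms(1,2)])
  have power: "f (real (Suc n)) \<le> f 1 ^ Suc n" for n
  proof (induction n)
    case (Suc n)
    have "f (real (Suc n) + 1) \<le> f (real (Suc n)) * f 1"
      unfolding f_def by (intro assms(3)[unfolded mult_sub_additive_on_def, rule_format]) auto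
    also have "\<dots> \<le> f 1 ^ Suc (Suc n)"
      using Suc f1 by simp
    finally show ?case by (simp add: add_ac)
  qed simp
  define L where "L = ln (f 1)"
  have "L > 0" using f1 by (simp add: L_def)
  \<comment> \<open>Twice the permitted rate, so one factor exp L ^ Suc n survives the cancellation
    below.\<close>
  define M where "M = 2 * L"
  have "M > 0" using \<open>L > 0\<close> by (simp add: M_def)
  have "(\<lambda>k. (a * real k + b + a) powr a / real (Suc k)) \<longlonglongrightarrow> 0"
    using \<open>a > 0\<close> \<open>a < 1\<close> by real_asymp
  then have "\<forall>\<^sub>F k in sequentially. (a * real k + b + a) powr a / real (Suc k) < 1 / M"
    by (rule order_tendstoD) (use \<open>M > 0\<close> in simp)
  then have "\<forall>\<^sub>F k in sequentially. real (Suc k) * ml_coeff a b (Suc k) \<ge> M * ml_coeff a b k"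
  proof eventually_elim
    case (elim k)
    have "a * real k + b > 0"
      using assms by (auto intro: add_nonneg_pos)
    then have "gamma_ratio a (a * real k + b) \<le> 1 / M * real (Suc k)"
      using elim gamma_ratio_le[OF assms(1), of "a * real k + b"] by (simp add: field_simps)
    then have "M * gamma_ratio a (a * real k + b) * ml_coeff a b (Suc k) \<le> real (Suc k) * ml_coeff a b (Suc k)"
      using \<open>M > 0\<close> ml_coeff_pos[OF assms(1,2), of "Suc k"]
      by (intro mult_right_mono) (auto simp: field_simps)
    then show ?case
      by (simp add: gamma_ratio_mult_ml_coeff[OF assms(1,2)] mult.assoc)
  qed
  from power_series_ge_exp[OF ml_coeff_pos[OF assms(1,2)] \<open>M > 0\<close> summable_ml[OF assms(1,2)] this]
  obtain K where K: "K > 0" "\<And>x. x \<ge> 0 \<Longrightarrow> K * exp (M * x) \<le> mittag_leffler a b x"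
    unfolding mittag_leffler_eq by blast
  have "Gamma b * K * exp L ^ Suc n \<le> 1" for n
  proof -
    have "exp M = exp L * exp L"
      unfolding exp_add[symmetric] by (simp add: M_def)
    then have "exp (M * real (Suc n)) = exp L ^ Suc n * exp L ^ Suc n"
      by (simp only: exp_of_nat2_mult power_mult_distrib)
    then have "Gamma b * K * exp L ^ Suc n * exp L ^ Suc n = Gamma b * (K * exp (M * real (Suc n)))"
      by simp
    also have "\<dots> \<le> f (real (Suc n))"
      using mult_left_mono[OF K(2)[of "real (Suc n)"], of "Gamma b"] assms(2)
      by (simp add: f_def mittag_leffler_normalized_def)
    also have "\<dots> \<le> exp L ^ Suc n"
      using power[of n] f1 by (simp add: L_def)
    finally show ?thesis
      by (simp del: power_Suc)
  qed
  then have "exp L ^ Suc n \<le> 1 / (Gamma b * K)" for n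
    using K(1) assms(2) by (simp add: field_simps del: power_Suc)
  moreover obtain n where "1 / (Gamma b * K) < exp L ^ n"
    using real_arch_pow[of "exp L"] \<open>L > 0\<close> by auto
  moreover have "exp L ^ n \<le> exp L ^ Suc n"
    using \<open>L > 0\<close> by (intro power_increasing) auto
  ultimately show False
    by (meson leD le_less_trans less_le_trans)
qed

text \<open>Each triple of equivalences closes as a cycle: convexity or concavity gives additivity,
  additivity gives the parameter conditions, and these give back convexity or concavity.\<close>

theorem mainTheorem7:
  fixes \<alpha> \<beta> :: real
  assumes "\<alpha> > 0" and "\<beta> > 0"
  shows "(log_convex_on {0<..} (mittag_leffler \<alpha> \<beta>) \<longleftrightarrow>
            mult_super_additive_on {0<..} (mittag_leffler_normalized \<alpha> \<beta>)) \<and>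
         (mult_super_additive_on {0<..} (mittag_leffler_normalized \<alpha> \<beta>) \<longleftrightarrow>
            \<alpha> \<le> 1 \<and> \<beta> \<ge> h \<alpha>) \<and>
         (log_concave_on {0<..} (mittag_leffler \<alpha> \<beta>) \<longleftrightarrow>
            mult_sub_additive_on {0<..} (mittag_leffler_normalized \<alpha> \<beta>)) \<and>
         (mult_sub_additive_on {0<..} (mittag_leffler_normalized \<alpha> \<beta>) \<longleftrightarrow>
            \<alpha> \<ge> 1 \<and> \<beta> \<le> h \<alpha>)"
  using log_convex_imp_super_additive_ml[OF assms] log_concave_imp_sub_additive_ml[OF assms]
    super_additive_ml_imp_h_le[OF assms] super_additive_ml_imp_le_1[OF assms]
    sub_additive_ml_imp_le_h[OF assms] sub_additive_ml_imp_ge_1[OF assms]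
    log_convex_on_ml[OF assms(1) _ assms(2)] log_concave_on_ml[OF _ assms(2)]
  by blast

end
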